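(* Let $I$ be a nonzero ideal of $\mathbb{Z}[\zeta_{16}+\zeta_{16}^7]$. Then there exists a generator $\alpha'$ of $I$ (i.e. $I=(\alpha')$) which is a shortest nonzero vector of $I$ under the canonical embedding of $\mathbb{Q}(\zeta_{16}+\zeta_{16}^7)$, i.e. $\|\Sigma(\alpha')\|\le\|\Sigma(\gamma)\|$ for every nonzero $\gamma\in I$.
   Context: $\zeta_{16}=e^{2\pi i/16}$; $\mathbb{Q}(\zeta_{16}+\zeta_{16}^7)$ is a degree-4 subfield of $\mathbb{Q}(\zeta_{16})$ whose ring of integers is $\mathbb{Z}[\zeta_{16}+\zeta_{16}^7]$. For a number field $\mathbb{K}$ with complex embeddings $\varphi_1,\dots,\varphi_t$ (all of them), the canonical embedding is $\Sigma_{\mathbb{K}}(x)=(\varphi_1(x),\dots,\varphi_t(x))$ with $\|\Sigma_{\mathbb{K}}(x)\|^2=\sum_j|\varphi_j(x)|^2$. *)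

theory Defs
  imports Complex_Main "HOL-Algebra.Ideal" "HOL-Computational_Algebra.Polynomial"
begin

definition zeta16 :: complex where
  "zeta16 = cis (2 * pi / 16)"

definition theta :: complex where
  "theta = zeta16 + zeta16 ^ 7"

text \<open>The field Q(theta) = Q[theta] (theta algebraic), as a subset of the complex numbers.\<close>
definition Ktheta :: "complex set" where
  "Ktheta = {poly (map_poly of_rat p) theta | p :: rat poly. True}"

definition Otheta :: "complex set" where
  "Otheta = {poly (map_poly of_int p) theta | p :: int poly. True}"

definition Otheta_ring :: "complex ring" where
  "Otheta_ring = \<lparr>carrier = Otheta, monoid.mult = (*), one = 1, zero = 0, add = (+)\<rparr>"

text \<open>All complex embeddings of K = Q(theta): field homomorphisms K -> C,
  normalised to 0 outside K so that each embedding is a unique HOL function.\<close>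
definition complex_embeddings :: "(complex \<Rightarrow> complex) set" where
  "complex_embeddings = {\<phi>.
      \<phi> 1 = 1 \<and>
      (\<forall>x\<in>Ktheta. \<forall>y\<in>Ktheta. \<phi> (x + y) = \<phi> x + \<phi> y \<and> \<phi> (x * y) = \<phi> x * \<phi> y) \<and>
      (\<forall>x. x \<notin> Ktheta \<longrightarrow> \<phi> x = 0)}"

definition canon_norm :: "complex \<Rightarrow> real" where
  "canon_norm x = sqrt (\<Sum>\<phi>\<in>complex_embeddings. (cmod (\<phi> x))\<^sup>2)"

end

theory Submission
  imports Defs
begin

text \<open>Write \<open>N\<close> for the absolute norm and \<open>4 T\<close> for the squared length of the canonical embedding.
  On the basis \<open>1, s, theta, (1 + s) theta\<close> with \<open>s = theta\<^sup>2 + 2 = sqrt 2\<close>, the relative norm to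
  \<open>Q(sqrt 2)\<close> is \<open>T + V sqrt 2\<close>, where \<open>T = a\<^sup>2 + 2b\<^sup>2 + 2c\<^sup>2 + 2d\<^sup>2\<close>, so that \<open>N = T\<^sup>2 - 2V\<^sup>2 \<le> T\<^sup>2\<close>.

  An element \<open>\<alpha>\<close> of least nonzero norm generates \<open>I\<close>. Let \<open>x \<in> J = \<alpha>\<^sup>-\<^sup>1 I\<close>, where every nonzero element
  has norm at least 1. Rounding the coordinates of \<open>x\<close>, and then those of twice the remainder, leaves
  remainders with \<open>4 T\<^sub>1 + 3 T\<^sub>2 \<le> 7\<close>; hence one of them has \<open>T < 1\<close> and vanishes, or equality holds and
  \<open>4x\<close> is integral. So \<open>4x\<close> is integral in any case. As 2 is a unit times \<open>theta ^ 4\<close> and the residue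
  field of \<open>theta\<close> is \<open>F\<^sub>2\<close>, a non-integral \<open>x\<close> would put \<open>1 / theta\<close>, of norm 1/2, into \<open>J\<close>.

  Among the elements of least norm choose \<open>\<alpha>\<close> with least \<open>T\<close>. Comparing it with its multiples by the
  units \<open>1 + sqrt 2\<close> and \<open>1 - sqrt 2\<close> gives \<open>T \<le> 3T - 4|V|\<close>, whence \<open>T\<^sup>2 \<le> 2N\<close>. A nonzero element of \<open>I\<close>
  that is not a generator has norm at least \<open>2 N(\<alpha>) \<ge> T(\<alpha>)\<^sup>2\<close>, hence is at least as long.\<close>

section \<open>Coordinates, relative norm and absolute norm\<close>

type_synonym quad = "real \<times> real \<times> real \<times> real"

text \<open>The argument \<open>r\<close> runs through all conjugates of \<open>theta\<close>, so
  one coordinate vector serves every embedding. With \<open>r\<^sup>2 + 3\<close> in place of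
  \<open>r\<^sup>2 + 2\<close> in the last basis element, the form \<open>qT\<close> becomes
  diagonal.\<close>

fun qval :: "complex \<Rightarrow> quad \<Rightarrow> complex" where
  "qval r (a, b, c, d) = of_real a + of_real b * (r\<^sup>2 + 2) + (of_real c + of_real d * (r\<^sup>2 + 3)) * r"

fun qT :: "quad \<Rightarrow> real" where
  "qT (a, b, c, d) = a\<^sup>2 + 2 * b\<^sup>2 + 2 * c\<^sup>2 + 2 * d\<^sup>2"

fun qV :: "quad \<Rightarrow> real" where
  "qV (a, b, c, d) = 2 * a * b + 2 * c * d + d\<^sup>2 - c\<^sup>2"

definition qN :: "quad \<Rightarrow> real" where
  "qN q = (qT q)\<^sup>2 - 2 * (qV q)\<^sup>2"

fun qmul :: "quad \<Rightarrow> quad \<Rightarrow> quad" where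
  "qmul (a, b, c, d) (a', b', c', d') =
    (a * a' + 2 * b * b' - 2 * c * c' - 2 * d * d',
     a * b' + b * a' + c * c' - c * d' - d * c' - d * d',
     a * c' + c * a' - b * c' - c * b' + b * d' + d * b',
     a * d' + d * a' + b * c' + c * b' + b * d' + d * b')"

fun qadd :: "quad \<Rightarrow> quad \<Rightarrow> quad" where
  "qadd (a, b, c, d) (a', b', c', d') = (a + a', b + b', c + c', d + d')"

definition quads :: "real set \<Rightarrow> quad set" where
  "quads S = S \<times> S \<times> S \<times> S"

text \<open>These are the roots of X^4 + 4 X^2 + 2, that is, the conjugates of
  \<open>theta\<close>.\<close>

definition roots4 :: "complex set" where
  "roots4 = {r. (r\<^sup>2 + 2)\<^sup>2 = 2}"

lemma qval_qadd: "qval r (qadd p q) = qval r p + qval r q"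
  by (cases p; cases q) (simp add: algebra_simps)

lemma qval_qmul:
  assumes "r \<in> roots4"
  shows "qval r (qmul p q) = qval r p * qval r q"
proof -
  obtain a b c d where p: "p = (a, b, c, d)" by (cases p) auto
  obtain a' b' c' d' where q: "q = (a', b', c', d')" by (cases q) auto
  define s where "s = r\<^sup>2 + 2"
  have rr: "r * r = s - 2" and s2: "r\<^sup>2 + 2 = s" and s3: "r\<^sup>2 + 3 = s + 1"
    by (simp_all add: s_def power2_eq_square)
  have ss: "s * s = 2" using assms by (simp add: roots4_def s_def power2_eq_square)
  \<comment> \<open>The relations are repeated under a further factor so that nested products also
    reduce to the basis.\<close>
  have rx: "r * (r * x) = s * x - 2 * x" for x
    using arg_cong[OF rr, of "\<lambda>y. y * x"] by (simp add: algebra_simps)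
  have sx: "s * (s * x) = 2 * x" for x
    using arg_cong[OF ss, of "\<lambda>y. y * x"] by (simp add: algebra_simps)
  show ?thesis unfolding p q qmul.simps qval.simps s2 s3
    by (simp add: algebra_simps rr ss rx sx)
qed

text \<open>Multiplicativity of the relative norm T + V sqrt 2, split into its rational and its sqrt
  2 part; the second half is \<open>qV_qmul\<close>.\<close>

lemma qT_qmul: "qT (qmul p q) = qT p * qT q + 2 * qV p * qV q"
  by (cases p; cases q) (simp add: power2_eq_square algebra_simps)

lemma qV_qmul: "qV (qmul p q) = qT p * qV q + qV p * qT q"
  by (cases p; cases q) (simp add: power2_eq_square algebra_simps)

lemma qN_qmul: "qN (qmul p q) = qN p * qN q"
  unfolding qN_def qT_qmul qV_qmul by (simp add: power2_eq_square algebra_simps)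

lemma qT_nonneg: "qT q \<ge> 0"
  by (cases q) simp

lemma qT_eq_0_iff: "qT q = 0 \<longleftrightarrow> q = (0, 0, 0, 0)"
proof (cases q)
  case (fields a b c d)
  have "a\<^sup>2 + 2 * b\<^sup>2 + 2 * c\<^sup>2 + 2 * d\<^sup>2 = 0 \<Longrightarrow> a\<^sup>2 = 0 \<and> b\<^sup>2 = 0 \<and> c\<^sup>2 = 0 \<and> d\<^sup>2 = 0"
    using zero_le_power2[of a] zero_le_power2[of b] zero_le_power2[of c] zero_le_power2[of d] by linarith
  then show ?thesis by (auto simp: fields)
qed

lemma qN_le: "qN q \<le> (qT q)\<^sup>2"
  by (simp add: qN_def)

section \<open>Irrationality of sqrt 2 and vanishing of the norm\<close>

lemma sqrt2_not_Rats: "sqrt 2 \<notin> \<rat>"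
proof
  assume "sqrt 2 \<in> \<rat>"
  then obtain m n :: nat where n: "n \<noteq> 0" and eq: "\<bar>sqrt 2\<bar> = m / n" and cop: "coprime m n"
    by (rule Rats_abs_nat_div_natE)
  have "sqrt 2 * real n = m" using eq n by simp
  hence "(sqrt 2 * real n)\<^sup>2 = (real m)\<^sup>2" by simp
  hence "real (2 * n\<^sup>2) = real (m\<^sup>2)" by (simp add: power_mult_distrib)
  hence e: "2 * n\<^sup>2 = m\<^sup>2" using of_nat_eq_iff by blast
  hence "even (m\<^sup>2)" by (metis dvd_triv_left)
  hence "even m" by simp
  then obtain k where k: "m = 2 * k" ..
  hence "n\<^sup>2 = 2 * k\<^sup>2" using e by (simp add: power_mult_distrib)
  hence "even (n\<^sup>2)" by simp
  hence "even n" by simp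
  with \<open>even m\<close> cop show False by (meson coprime_common_divisor_nat dvd_def even_numeral not_coprimeI odd_one)
qed

lemma rat_sqrt2_zero:
  assumes "x \<in> \<rat>" "y \<in> \<rat>" "x + y * sqrt 2 = 0"
  shows "x = 0"
proof (cases "y = 0")
  case False
  hence "sqrt 2 = - x / y" using assms(3) by (simp add: field_simps)
  also have "\<dots> \<in> \<rat>" using assms by simp
  finally show ?thesis using sqrt2_not_Rats by simp
qed (use assms in simp)

lemma qT_qV_qN_closed:
  assumes "q \<in> quads S" "S = \<int> \<or> S = \<rat>" shows "qT q \<in> S" "qV q \<in> S" "qN q \<in> S"
proof -
  show "qT q \<in> S" "qV q \<in> S" using assms by (cases q; auto simp: quads_def)+
  then show "qN q \<in> S" using assms(2) by (auto simp: qN_def)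
qed

lemma quads_closed:
  assumes "p \<in> quads S" "q \<in> quads S" "S = \<int> \<or> S = \<rat>" shows "qmul p q \<in> quads S" "qadd p q \<in> quads S"
  using assms by (cases p; cases q; auto simp: quads_def)+

lemma quads_Ints_Rats: "q \<in> quads \<int> \<Longrightarrow> q \<in> quads \<rat>"
  using Ints_subset_Rats by (auto simp: quads_def)

lemma qN_eq: "qN q = (qT q + qV q * sqrt 2) * (qT q - qV q * sqrt 2)"
  by (simp add: qN_def power2_eq_square algebra_simps)

text \<open>One of the conjugate factors T + V sqrt 2 and T - V sqrt 2 vanishes; irrationality then
  gives T = 0, and \<open>qT\<close> is positive definite.\<close>

lemma qN_eq_0:
  assumes "q \<in> quads \<rat>" "qN q = 0"
  shows "q = (0, 0, 0, 0)"
proof -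
  have "qT q \<in> \<rat>" "qV q \<in> \<rat>" using qT_qV_qN_closed[OF assms(1)] by auto
  moreover have "qT q + qV q * sqrt 2 = 0 \<or> qT q + (- qV q) * sqrt 2 = 0" using assms(2) by (simp add: qN_eq)
  ultimately have "qT q = 0" using rat_sqrt2_zero[of "qT q" "qV q"] rat_sqrt2_zero[of "qT q" "- qV q"] by auto
  thus ?thesis by (simp add: qT_eq_0_iff)
qed

text \<open>Here t is sqrt 2 or its negative. Since r^2 = t - 2 is negative, r is purely imaginary,
  so a + b t is the real part of the value and (c + d (t + 1)) r is the rest.\<close>

lemma cmod_qval:
  assumes "r\<^sup>2 = of_real (t - 2)" "t\<^sup>2 = 2"
  shows "(cmod (qval r q))\<^sup>2 = qT q + qV q * t"
proof -
  obtain a b c d where q: "q = (a, b, c, d)" by (cases q) auto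
  have tt: "t * t = 2" using assms(2) by (simp add: power2_eq_square)
  have tx: "t * (t * x) = 2 * x" for x
    using tt by (simp flip: mult.assoc)
  have "t\<^sup>2 < 2\<^sup>2" using assms by simp
  hence "t < 2" by (meson less_eq_real_def linorder_not_less power_mono zero_le_numeral)
  have "Re r ^ 2 - Im r ^ 2 = t - 2" "2 * Re r * Im r = 0"
    using assms(1) by (auto simp: complex_eq_iff power2_eq_square)
  moreover have "Im r \<noteq> 0"
  proof
    assume "Im r = 0"
    hence "Re r ^ 2 = t - 2" using calculation by simp
    thus False using \<open>t < 2\<close> zero_le_power2[of "Re r"] by linarith
  qed
  ultimately have r: "Re r = 0" "Im r ^ 2 = 2 - t" by auto
  have v: "qval r q = of_real a + of_real b * of_real t + (of_real c + of_real d * of_real (t + 1)) * r"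
    unfolding q qval.simps assms(1) by simp
  have re: "Re (qval r q) = a + b * t" and im: "Im (qval r q) = (c + d * (t + 1)) * Im r"
    unfolding v using r by simp_all
  have "(cmod (qval r q))\<^sup>2 = (a + b * t)\<^sup>2 + (c + d * (t + 1))\<^sup>2 * (2 - t)"
    unfolding cmod_power2 re im power_mult_distrib r(2) ..
  also have "\<dots> = qT q + qV q * t" unfolding q qT.simps qV.simps 
    by (simp add: power2_eq_square algebra_simps tt tx)
  finally show ?thesis .
qed

section \<open>The ring and the field generated by \<open>theta\<close>, in coordinates\<close>

lemma theta_sq: "theta\<^sup>2 = of_real (sqrt 2 - 2)"
proof -
  \<comment> \<open>The cross term is 2 \<open>zeta16 ^ 8\<close> = -2, and the outer terms are
    complex conjugates with sum 2 cos (pi / 4) = sqrt 2.\<close>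
  have "theta\<^sup>2 = zeta16 ^ 2 + 2 * zeta16 ^ 8 + zeta16 ^ 14"
    by (simp add: theta_def power2_sum flip: power_mult) (simp add: eval_nat_numeral)
  also have "zeta16 ^ 2 = cis (pi / 4)" unfolding zeta16_def DeMoivre by (rule arg_cong[of _ _ cis]) simp
  also have "zeta16 ^ 8 = cis pi" unfolding zeta16_def DeMoivre by (rule arg_cong[of _ _ cis]) simp
  also have "zeta16 ^ 14 = cis (- (pi / 4) + 2 * pi)" unfolding zeta16_def DeMoivre by (rule arg_cong[of _ _ cis]) (simp add: field_simps)
  also have "\<dots> = cis (- (pi / 4))" unfolding cis_mult[symmetric] by simp
  finally show ?thesis by (simp add: complex_eq_iff cos_45 sin_45)
qed

lemma theta_roots4: "theta \<in> roots4"
  unfolding roots4_def by (simp add: theta_sq flip: of_real_power)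

lemma qval_eq_0:
  assumes "q \<in> quads \<rat>" "qval theta q = 0" shows "q = (0, 0, 0, 0)"
proof -
  have "qT q + qV q * sqrt 2 = 0" using cmod_qval[OF theta_sq, of q] assms by simp
  thus ?thesis using qN_eq_0[OF assms(1)] by (simp add: qN_eq)
qed

lemma qval_inj:
  assumes "p \<in> quads \<rat>" "q \<in> quads \<rat>" "qval theta p = qval theta q" shows "p = q"
proof -
  have m: "qmul (-1, 0, 0, 0) q \<in> quads \<rat>" by (rule quads_closed) (use assms in \<open>auto simp: quads_def\<close>)
  have "qadd p (qmul (-1, 0, 0, 0) q) = (0, 0, 0, 0)"
    by (rule qval_eq_0) (use quads_closed m assms in \<open>auto simp: qval_qadd qval_qmul[OF theta_roots4]\<close>)
  thus ?thesis by (cases p; cases q) auto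
qed

text \<open>Taking h to be \<open>of_int\<close> or \<open>of_rat\<close> treats the ring and the
  field at once. The change between the power basis and the chosen basis is unimodular, so it works
  over the integers too.\<close>

lemma poly_range_eq:
  fixes h :: "'a::comm_ring_1 \<Rightarrow> real"
  assumes h: "h 0 = 0" "\<And>x y. h (x + y) = h x + h y" and S: "range h = S" "S = \<int> \<or> S = \<rat>"
  shows "{poly (map_poly (\<lambda>x. complex_of_real (h x)) p) theta | p. True} = qval theta ` quads S"
proof (intro equalityI subsetI)
  fix x assume "x \<in> {poly (map_poly (\<lambda>x. complex_of_real (h x)) p) theta | p. True}"
  then obtain p where "x = poly (map_poly (\<lambda>x. complex_of_real (h x)) p) theta" by blast
  moreover have "poly (map_poly (\<lambda>x. complex_of_real (h x)) p) theta \<in> qval theta ` quads S" for p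
  proof (induction p)
    case 0
    have "(0, 0, 0, 0) \<in> quads S" using S(2) by (auto simp: quads_def)
    thus ?case by (force simp: image_iff)
  next
    case (pCons a p)
    then obtain q where q: "q \<in> quads S" "poly (map_poly (\<lambda>x. complex_of_real (h x)) p) theta = qval theta q" by blast
    have 1: "(h a, 0, 0, 0) \<in> quads S" "(0, 0, 1, 0) \<in> quads S" using S by (auto simp: quads_def)
    \<comment> \<open>Horner step: (0, 0, 1, 0) are the coordinates of \<open>theta\<close>.\<close>
    have "poly (map_poly (\<lambda>x. complex_of_real (h x)) (pCons a p)) theta = qval theta (qadd (h a, 0, 0, 0) (qmul (0, 0, 1, 0) q))"
      by (simp add: map_poly_pCons h q qval_qadd qval_qmul[OF theta_roots4])
    thus ?case using quads_closed 1 q S(2) by blast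
  qed
  ultimately show "x \<in> qval theta ` quads S" by blast
next
  fix x assume "x \<in> qval theta ` quads S"
  then obtain q where q: "q \<in> quads S" "x = qval theta q" by blast
  then obtain a b c d where "q = (h a, h b, h c, h d)" using S(1) by (auto simp: quads_def)
  \<comment> \<open>Expanding the basis gives (a + 2b) + (c + 3d) \<open>theta\<close> + b
    \<open>theta ^ 2\<close> + d \<open>theta ^ 3\<close>; the multiples are written as sums because
    h is only assumed additive.\<close>
  with q have "x = poly (map_poly (\<lambda>x. complex_of_real (h x)) [:a + (b + b), c + (d + (d + d)), b, d:]) theta"
    by (simp only: map_poly_pCons h poly_pCons qval.simps of_real_add of_real_0 map_poly_0 poly_0)
       (simp add: algebra_simps power2_eq_square)
  thus "x \<in> {poly (map_poly (\<lambda>x. complex_of_real (h x)) p) theta | p. True}" by blast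
qed

lemma Otheta_eq: "Otheta = qval theta ` quads \<int>"
proof -
  have "{poly (map_poly (\<lambda>x. complex_of_real (of_int x)) p) theta | p. True} = qval theta ` quads \<int>"
    by (rule poly_range_eq) (auto simp: Ints_def)
  thus ?thesis unfolding Otheta_def by simp
qed

lemma Ktheta_eq: "Ktheta = qval theta ` quads \<rat>"
proof -
  have "{poly (map_poly (\<lambda>x. complex_of_real (of_rat x)) p) theta | p. True} = qval theta ` quads \<rat>"
    by (rule poly_range_eq) (auto simp: Rats_def of_rat_add)
  moreover have "complex_of_real (of_rat x) = of_rat x" for x
    by (cases x) (simp add: of_rat_rat)
  ultimately show ?thesis unfolding Ktheta_def by simp
qed

lemma Otheta_closed:
  assumes "x \<in> Otheta" "y \<in> Otheta" shows "x + y \<in> Otheta" "x * y \<in> Otheta"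
proof -
  obtain p q where "p \<in> quads \<int>" "q \<in> quads \<int>" "x = qval theta p" "y = qval theta q"
    using assms unfolding Otheta_eq by blast
  thus "x + y \<in> Otheta" "x * y \<in> Otheta" 
    by (auto simp: Otheta_eq quads_closed simp flip: qval_qadd qval_qmul[OF theta_roots4])
qed

lemma Ktheta_closed:
  assumes "x \<in> Ktheta" "y \<in> Ktheta" shows "x + y \<in> Ktheta" "x * y \<in> Ktheta"
proof -
  obtain p q where "p \<in> quads \<rat>" "q \<in> quads \<rat>" "x = qval theta p" "y = qval theta q"
    using assms unfolding Ktheta_eq by blast
  thus "x + y \<in> Ktheta" "x * y \<in> Ktheta" 
    by (auto simp: Ktheta_eq quads_closed simp flip: qval_qadd qval_qmul[OF theta_roots4])
qed

section \<open>Complex embeddings and the canonical norm\<close>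

lemma roots4_eq:
  "roots4 = {\<i> * of_real (sqrt (2 - sqrt 2)), - (\<i> * of_real (sqrt (2 - sqrt 2))),
             \<i> * of_real (sqrt (2 + sqrt 2)), - (\<i> * of_real (sqrt (2 + sqrt 2)))}" (is "_ = ?R")
proof -
  have lt: "sqrt 2 \<le> 2" by (rule real_le_lsqrt) auto
  have 1: "(\<i> * of_real (sqrt (2 - sqrt 2)))\<^sup>2 = of_real (sqrt 2 - 2)"
    and 2: "(\<i> * of_real (sqrt (2 + sqrt 2)))\<^sup>2 = of_real (- sqrt 2 - 2)"
    using lt by (simp_all add: power_mult_distrib flip: of_real_power)
  have "(r\<^sup>2 + 2)\<^sup>2 = 2 \<longleftrightarrow> r \<in> ?R" for r
  proof -
    have "(2::complex) = (of_real (sqrt 2))\<^sup>2" by (simp flip: of_real_power)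
    hence "(r\<^sup>2 + 2)\<^sup>2 = 2 \<longleftrightarrow> r\<^sup>2 + 2 = of_real (sqrt 2) \<or> r\<^sup>2 + 2 = - of_real (sqrt 2)"
      by (metis power2_eq_iff)
    also have "\<dots> \<longleftrightarrow> r\<^sup>2 = (\<i> * of_real (sqrt (2 - sqrt 2)))\<^sup>2 \<or> r\<^sup>2 = (\<i> * of_real (sqrt (2 + sqrt 2)))\<^sup>2"
      unfolding 1 2 by (auto simp: algebra_simps eq_diff_eq)
    also have "\<dots> \<longleftrightarrow> r \<in> ?R" unfolding power2_eq_iff by simp
    finally show ?thesis .
  qed
  thus ?thesis unfolding roots4_def by blast
qed

text \<open>Two of the roots contribute T + V sqrt 2 each and the other two T - V sqrt 2, so V
  cancels.\<close>

lemma sum_roots4: "(\<Sum>r\<in>roots4. (cmod (qval r q))\<^sup>2) = 4 * qT q"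
proof -
  have lt: "sqrt 2 < 2" by (rule real_less_lsqrt) auto
  define A B where "A = sqrt (2 - sqrt 2)" and "B = sqrt (2 + sqrt 2)"
  have AB: "0 < A" "A < B" using lt by (simp_all add: A_def B_def)
  have A: "(\<i> * of_real A)\<^sup>2 = complex_of_real (sqrt 2 - 2)" "(- (\<i> * of_real A))\<^sup>2 = complex_of_real (sqrt 2 - 2)"
    and B: "(\<i> * of_real B)\<^sup>2 = complex_of_real (- sqrt 2 - 2)" "(- (\<i> * of_real B))\<^sup>2 = complex_of_real (- sqrt 2 - 2)"
    using lt by (simp_all add: A_def B_def power_mult_distrib flip: of_real_power)
  have "(\<Sum>r\<in>roots4. (cmod (qval r q))\<^sup>2) = (cmod (qval (\<i> * of_real A) q))\<^sup>2 + (cmod (qval (- (\<i> * of_real A)) q))\<^sup>2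
      + (cmod (qval (\<i> * of_real B) q))\<^sup>2 + (cmod (qval (- (\<i> * of_real B)) q))\<^sup>2"
    unfolding roots4_eq A_def[symmetric] B_def[symmetric] using AB by (simp add: complex_eq_iff)
  also have "\<dots> = 4 * qT q"
    using cmod_qval[OF A(1), of q] cmod_qval[OF A(2), of q] cmod_qval[OF B(1), of q] cmod_qval[OF B(2), of q]
    by simp
  finally show ?thesis .
qed

text \<open>Both factors in \<open>qN_eq\<close> are squared absolute values, one at
  \<open>theta\<close> and one at a root of the other conjugate pair.\<close>

lemma qN_nonneg: "qN q \<ge> 0"
proof -
  have lt: "sqrt 2 < 2" by (rule real_less_lsqrt) auto
  have "(\<i> * of_real (sqrt (2 + sqrt 2)))\<^sup>2 = complex_of_real (- sqrt 2 - 2)"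
    by (simp add: power_mult_distrib flip: of_real_power)
  from cmod_qval[OF this, of q] cmod_qval[OF theta_sq, of q] show ?thesis
    unfolding qN_eq by (intro mult_nonneg_nonneg) (metis zero_le_power2 real_sqrt_pow2 power2_minus zero_le_numeral mult_minus_right diff_conv_add_uminus)+
qed

text \<open>The embedding sending \<open>theta\<close> to r: coordinates are read off at
  \<open>theta\<close> and evaluated at r. The value 0 outside the field matches the normalisation
  in \<open>complex_embeddings\<close>.\<close>

definition emb :: "complex \<Rightarrow> complex \<Rightarrow> complex" where
  "emb r x = (if x \<in> Ktheta then qval r (inv_into (quads \<rat>) (qval theta) x) else 0)"

lemma emb_qval: "q \<in> quads \<rat> \<Longrightarrow> emb r (qval theta q) = qval r q"
  by (simp add: emb_def Ktheta_eq inj_on_def qval_inj inv_into_f_f)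

lemma of_rat_in_Ktheta: "of_rat x \<in> Ktheta" and theta_in_Ktheta: "theta \<in> Ktheta"
proof -
  have "of_rat x = qval theta (of_rat x, 0, 0, 0)" by (cases x) (simp add: of_rat_rat)
  moreover have "theta = qval theta (0, 0, 1, 0)" by simp
  moreover have "(of_rat x, 0, 0, 0) \<in> quads \<rat>" "(0, 0, 1, 0) \<in> quads \<rat>" by (auto simp: quads_def)
  ultimately show "of_rat x \<in> Ktheta" "theta \<in> Ktheta" unfolding Ktheta_eq by (metis imageI)+
qed

lemma emb_theta: "emb r theta = r"
  using emb_qval[of "(0, 0, 1, 0)" r] by (simp add: quads_def)

lemma embedding_of_rat:
  fixes \<phi> :: "complex \<Rightarrow> complex"
  assumes "\<phi> 1 = 1"
    and add: "\<And>x y. x \<in> Ktheta \<Longrightarrow> y \<in> Ktheta \<Longrightarrow> \<phi> (x + y) = \<phi> x + \<phi> y"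
    and mult: "\<And>x y. x \<in> Ktheta \<Longrightarrow> y \<in> Ktheta \<Longrightarrow> \<phi> (x * y) = \<phi> x * \<phi> y"
  shows "\<phi> (of_rat x) = of_rat x"
proof -
  have K: "of_int m \<in> Ktheta" for m using of_rat_in_Ktheta[of "of_int m"] by simp
  have 0: "\<phi> 0 = 0" using add[OF K[of 0] K[of 0]] by simp
  have int: "\<phi> (of_int m) = of_int m" for m
  proof (induction m rule: int_induct[where k = 0])
    case (step1 i)
    then show ?case using add[OF K[of i] K[of 1]] assms(1) by simp
  next
    case (step2 i)
    then show ?case using add[OF K[of "i - 1"] K[of 1]] assms(1) by (simp add: eq_diff_eq)
  qed (simp add: 0)
  obtain a b where x: "x = Rat.Fract a b" "b > 0" by (cases x)
  hence e: "of_int b * of_rat x = (of_int a :: complex)" by (simp add: of_rat_rat)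
  have "\<phi> (of_int b * of_rat x) = of_int b * \<phi> (of_rat x)"
    by (simp only: mult[OF K of_rat_in_Ktheta] int)
  hence "of_int b * \<phi> (of_rat x) = of_int b * of_rat x" by (simp only: e int)
  moreover have "(of_int b :: complex) \<noteq> 0" using x(2) by simp
  ultimately show ?thesis using mult_left_cancel by blast
qed

lemma embedding_eq_emb:
  assumes "\<phi> \<in> complex_embeddings"
  shows "\<phi> theta \<in> roots4" "\<phi> = emb (\<phi> theta)"
proof -
  have one: "\<phi> 1 = 1" and out: "\<And>x. x \<notin> Ktheta \<Longrightarrow> \<phi> x = 0"
    and add: "\<And>x y. x \<in> Ktheta \<Longrightarrow> y \<in> Ktheta \<Longrightarrow> \<phi> (x + y) = \<phi> x + \<phi> y"
    and mult: "\<And>x y. x \<in> Ktheta \<Longrightarrow> y \<in> Ktheta \<Longrightarrow> \<phi> (x * y) = \<phi> x * \<phi> y"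
    using assms unfolding complex_embeddings_def by auto
  note rat = embedding_of_rat[OF one add mult]
  note K = of_rat_in_Ktheta theta_in_Ktheta Ktheta_closed
  have K2: "2 \<in> Ktheta" "3 \<in> Ktheta" using of_rat_in_Ktheta[of 2] of_rat_in_Ktheta[of 3] by simp_all
  have r2: "\<phi> 2 = 2" "\<phi> 3 = 3" using rat[of 2] rat[of 3] by simp_all
  \<comment> \<open>An embedding preserves the defining relation of \<open>theta\<close>, so it
    sends \<open>theta\<close> to a conjugate.\<close>
  have "\<phi> ((theta\<^sup>2 + 2)\<^sup>2) = ((\<phi> theta)\<^sup>2 + 2)\<^sup>2"
    by (simp add: power2_eq_square add mult K K2 r2)
  also have "(theta\<^sup>2 + 2)\<^sup>2 = 2" using theta_roots4 by (simp add: roots4_def)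
  finally show "\<phi> theta \<in> roots4" by (simp add: roots4_def r2)
  have val: "\<phi> (qval theta q) = qval (\<phi> theta) q" if "q \<in> quads \<rat>" for q
  proof -
    obtain a b c d where "q = (of_rat a, of_rat b, of_rat c, of_rat d)"
      using \<open>q \<in> quads \<rat>\<close> by (auto simp: quads_def Rats_def)
    moreover have "complex_of_real (of_rat x) = of_rat x" for x by (cases x) (simp add: of_rat_rat)
    ultimately show ?thesis by (simp add: power2_eq_square add mult K K2 r2 rat)
  qed
  show "\<phi> = emb (\<phi> theta)"
  proof
    fix x show "\<phi> x = emb (\<phi> theta) x"
    proof (cases "x \<in> Ktheta")
      case True
      then obtain q where "q \<in> quads \<rat>" "x = qval theta q" unfolding Ktheta_eq by blast
      then show ?thesis by (simp add: val emb_qval)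
    qed (simp add: out emb_def)
  qed
qed

lemma emb_embedding:
  assumes "r \<in> roots4" shows "emb r \<in> complex_embeddings"
proof -
  have "emb r (qval theta (1, 0, 0, 0)) = 1" by (subst emb_qval) (auto simp: quads_def)
  hence "emb r 1 = 1" by simp
  moreover have "emb r (x + y) = emb r x + emb r y \<and> emb r (x * y) = emb r x * emb r y"
    if "x \<in> Ktheta" "y \<in> Ktheta" for x y
  proof -
    obtain p q where "p \<in> quads \<rat>" "q \<in> quads \<rat>" "x = qval theta p" "y = qval theta q"
      using \<open>x \<in> Ktheta\<close> \<open>y \<in> Ktheta\<close> unfolding Ktheta_eq by blast
    thus ?thesis
      using emb_qval[of "qadd p q" r] emb_qval[of "qmul p q" r]
      by (simp add: quads_closed emb_qval qval_qadd qval_qmul[OF theta_roots4] qval_qmul[OF assms])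
  qed
  moreover have "emb r x = 0" if "x \<notin> Ktheta" for x using that by (simp add: emb_def)
  ultimately show ?thesis unfolding complex_embeddings_def by simp
qed

text \<open>Embeddings correspond bijectively to \<open>roots4\<close> through the image of
  \<open>theta\<close>, so the sum over embeddings is the one in \<open>sum_roots4\<close>. From
  here on, comparing lengths means comparing \<open>qT\<close>.\<close>

lemma canon_norm_qval:
  assumes "q \<in> quads \<rat>" shows "canon_norm (qval theta q) = 2 * sqrt (qT q)"
proof -
  have emb: "complex_embeddings = emb ` roots4" using embedding_eq_emb emb_embedding by blast
  moreover have inj: "inj_on emb roots4" by (rule inj_onI) (metis emb_theta)
  ultimately have "(\<Sum>\<phi>\<in>complex_embeddings. (cmod (\<phi> (qval theta q)))\<^sup>2) = (\<Sum>r\<in>roots4. (cmod (qval r q))\<^sup>2)"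
    unfolding emb sum.reindex[OF inj] by (simp add: emb_qval[OF assms] del: qval.simps)
  thus ?thesis unfolding canon_norm_def sum_roots4 by (simp add: real_sqrt_mult)
qed

section \<open>Divisibility by \<open>theta\<close>\<close>

lemma Otheta_of_int: "of_int n \<in> Otheta" and theta_in_Otheta: "theta \<in> Otheta"
proof -
  have "of_int n = qval theta (of_int n, 0, 0, 0)" by simp
  moreover have "theta = qval theta (0, 0, 1, 0)" by simp
  moreover have "(of_int n, 0, 0, 0) \<in> quads \<int>" "(0, 0, 1, 0) \<in> quads \<int>" by (auto simp: quads_def)
  ultimately show "of_int n \<in> Otheta" "theta \<in> Otheta" unfolding Otheta_eq by (metis imageI)+
qed

text \<open>An integral element is divisible by \<open>theta\<close> exactly when its first
  coordinate is even. Otherwise subtracting 1 makes it divisible, so after division y differs from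
  an integral element by 1 / \<open>theta\<close>.\<close>

lemma Otheta_mult_theta_cases:
  assumes "theta * y \<in> Otheta"
  shows "y \<in> Otheta \<or> (\<exists>t\<in>Otheta. y + t = qval theta (0, 0, - 1 / 2, - 1 / 2))"
proof -
  note vm = qval_qmul[OF theta_roots4, symmetric]
  have theta0: "theta \<noteq> 0" using theta_roots4 by (auto simp: roots4_def)
  obtain a b c d :: int where y: "theta * y = qval theta (of_int a, of_int b, of_int c, of_int d)"
    using assms unfolding Otheta_eq by (auto simp: quads_def Ints_def)
  define k where "k = a div 2"
  have th: "theta = qval theta (0, 0, 1, 0)" by simp
  show ?thesis
  proof (cases "even a")
    case True
    hence a: "real_of_int a = 2 * of_int k" by (simp add: k_def real_of_int_div)
    \<comment> \<open>The coordinates come from multiplying (a, b, c, d) by 1 /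
      \<open>theta\<close>, with a = 2k.\<close>
    let ?z = "(of_int (c + d), of_int d, of_int (- k), of_int (- k - b)) :: quad"
    have "theta * y = theta * qval theta ?z"
      unfolding y by (subst (2) th, subst vm) (simp add: a algebra_simps)
    hence "y = qval theta ?z" using theta0 by (metis mult_left_cancel)
    thus ?thesis unfolding Otheta_eq by (auto simp: quads_def simp del: qval.simps)
  next
    case False
    hence "a = 2 * k + 1" by (simp add: k_def)
    hence a: "real_of_int a = 2 * of_int k + 1" by simp
    (* (0, 0, -1/2, -1/2) represents 1 / theta *)
    let ?z = "(of_int (- c - d), of_int (- d), of_int k, of_int (k + b)) :: quad"
    have "theta * (y + qval theta ?z) = theta * qval theta (0, 0, - 1 / 2, - 1 / 2)"
      unfolding distrib_left y by (subst (2 4) th, subst (1 2) vm, subst qval_qadd[symmetric]) (simp add: a algebra_simps)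
    hence "y + qval theta ?z = qval theta (0, 0, - 1 / 2, - 1 / 2)" using theta0 by (metis mult_left_cancel)
    moreover have "qval theta ?z \<in> Otheta" unfolding Otheta_eq by (auto simp: quads_def simp del: qval.simps)
    ultimately show ?thesis by blast
  qed
qed

section \<open>Simultaneous rounding of an element and of its double\<close>

lemma real_rounding:
  fixes t :: real
  obtains n m :: int where "4 * (t + n)\<^sup>2 + 3 * (2 * t + m)\<^sup>2 \<le> 1"
    "4 * (t + n)\<^sup>2 + 3 * (2 * t + m)\<^sup>2 = 1 \<longrightarrow> 4 * t \<in> \<int>"
proof -
  define u where "u = t - of_int (round t)"
  have "\<bar>u\<bar> \<le> 1 / 2" unfolding u_def using of_int_round_abs_le[of t] by (simp add: abs_minus_commute)
  have t: "4 * t = 4 * u + of_int (4 * round t)" by (simp add: u_def)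
  \<comment> \<open>With j = 0 the expression is 16 u^2, at most 1 up to |u| = 1/4. Beyond that, j =
    -1 or 1 gives a convex parabola equal to 1 at both |u| = 1/4 and |u| = 1/2; the ratio 4 : 3 of
    the weights is the one that makes these end values agree. Equality thus occurs only at multiples
    of 1/4.\<close>
  have "\<exists>j::int. 4 * u\<^sup>2 + 3 * (2 * u + j)\<^sup>2 \<le> 1 \<and> (4 * u\<^sup>2 + 3 * (2 * u + j)\<^sup>2 = 1 \<longrightarrow> 4 * u \<in> \<int>)"
  proof -
    consider "\<bar>u\<bar> \<le> 1 / 4" | "u > 1 / 4" | "u < - (1 / 4)" by linarith
    then show ?thesis
    proof cases
      case 1
      have e: "1 - (4 * u\<^sup>2 + 3 * (2 * u + of_int 0)\<^sup>2) = (1 - 4 * u) * (1 + 4 * u)"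
        by (simp add: power2_eq_square algebra_simps)
      have "(1 - 4 * u) * (1 + 4 * u) \<ge> 0" using 1 by (intro mult_nonneg_nonneg) auto
      moreover have "4 * u \<in> \<int>" if "(1 - 4 * u) * (1 + 4 * u) = 0"
      proof -
        have "4 * u = 1 \<or> 4 * u = -1" using that by auto
        thus ?thesis by auto
      qed
      ultimately show ?thesis using e by (intro exI[of _ 0]) auto
    next
      case 2
      have e: "1 - (4 * u\<^sup>2 + 3 * (2 * u + of_int (-1))\<^sup>2) = 2 * (1 - 2 * u) * (4 * u - 1)"
        by (simp add: power2_eq_square algebra_simps)
      have "2 * (1 - 2 * u) * (4 * u - 1) \<ge> 0" using 2 \<open>\<bar>u\<bar> \<le> 1 / 2\<close> by (intro mult_nonneg_nonneg) auto
      moreover have "4 * u \<in> \<int>" if "2 * (1 - 2 * u) * (4 * u - 1) = 0"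
      proof -
        have "4 * u = 1 \<or> 4 * u = 2" using that by auto
        thus ?thesis by (metis Ints_1 Ints_numeral)
      qed
      ultimately show ?thesis using e by (intro exI[of _ "-1"]) auto
    next
      case 3
      have e: "1 - (4 * u\<^sup>2 + 3 * (2 * u + of_int 1)\<^sup>2) = 2 * (1 + 2 * u) * (- 4 * u - 1)"
        by (simp add: power2_eq_square algebra_simps)
      have "2 * (1 + 2 * u) * (- 4 * u - 1) \<ge> 0" using 3 \<open>\<bar>u\<bar> \<le> 1 / 2\<close> by (intro mult_nonneg_nonneg) auto
      moreover have "4 * u \<in> \<int>" if "2 * (1 + 2 * u) * (- 4 * u - 1) = 0"
      proof -
        have "4 * u = -1 \<or> 4 * u = -2" using that by auto
        thus ?thesis by (metis Ints_1 Ints_numeral Ints_minus)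
      qed
      ultimately show ?thesis using e by (intro exI[of _ 1]) auto
    qed
  qed
  then obtain j :: int where j: "4 * u\<^sup>2 + 3 * (2 * u + j)\<^sup>2 \<le> 1" "4 * u\<^sup>2 + 3 * (2 * u + j)\<^sup>2 = 1 \<longrightarrow> 4 * u \<in> \<int>"
    by blast
  have e: "t + of_int (- round t) = u" "2 * t + of_int (j - 2 * round t) = 2 * u + j"
    by (simp_all add: u_def)
  show ?thesis
    by (rule that[of "- round t" "j - 2 * round t"]) (unfold e t, use j in auto)
qed

text \<open>Rounding the coordinates of q alone only bounds T by 7/4, since the weights in
  \<open>qT\<close> add up to 7; bringing in the double of q closes this gap except in the boundary
  case.\<close>

lemma quad_rounding:
  obtains n m where "n \<in> quads \<int>" "m \<in> quads \<int>"
    "qT (qadd q n) < 1 \<or> qT (qadd (qmul (2, 0, 0, 0) q) m) < 1 \<or> qmul (4, 0, 0, 0) q \<in> quads \<int>"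
proof -
  obtain a b c d where q: "q = (a, b, c, d)" by (cases q) auto
  obtain na ma :: int where A: "4 * (a + na)\<^sup>2 + 3 * (2 * a + ma)\<^sup>2 \<le> 1" "4 * (a + na)\<^sup>2 + 3 * (2 * a + ma)\<^sup>2 = 1 \<longrightarrow> 4 * a \<in> \<int>"
    by (rule real_rounding)
  obtain nb mb :: int where B: "4 * (b + nb)\<^sup>2 + 3 * (2 * b + mb)\<^sup>2 \<le> 1" "4 * (b + nb)\<^sup>2 + 3 * (2 * b + mb)\<^sup>2 = 1 \<longrightarrow> 4 * b \<in> \<int>"
    by (rule real_rounding)
  obtain nc mc :: int where C: "4 * (c + nc)\<^sup>2 + 3 * (2 * c + mc)\<^sup>2 \<le> 1" "4 * (c + nc)\<^sup>2 + 3 * (2 * c + mc)\<^sup>2 = 1 \<longrightarrow> 4 * c \<in> \<int>"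
    by (rule real_rounding)
  obtain nd md :: int where D: "4 * (d + nd)\<^sup>2 + 3 * (2 * d + md)\<^sup>2 \<le> 1" "4 * (d + nd)\<^sup>2 + 3 * (2 * d + md)\<^sup>2 = 1 \<longrightarrow> 4 * d \<in> \<int>"
    by (rule real_rounding)
  let ?n = "(of_int na, of_int nb, of_int nc, of_int nd) :: quad"
  let ?m = "(of_int ma, of_int mb, of_int mc, of_int md) :: quad"
  have "qmul (4, 0, 0, 0) q \<in> quads \<int>" if "\<not> qT (qadd q ?n) < 1" "\<not> qT (qadd (qmul (2, 0, 0, 0) q) ?m) < 1"
  proof -
    have T: "(a + na)\<^sup>2 + 2 * (b + nb)\<^sup>2 + 2 * (c + nc)\<^sup>2 + 2 * (d + nd)\<^sup>2 \<ge> 1"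
      "(2 * a + ma)\<^sup>2 + 2 * (2 * b + mb)\<^sup>2 + 2 * (2 * c + mc)\<^sup>2 + 2 * (2 * d + md)\<^sup>2 \<ge> 1"
      using that by (simp_all add: q)
    \<comment> \<open>If both remainders have T at least 1, the sum of the four bounds with weights
      1, 2, 2, 2 is both at most 7 and at least 4 + 3, so each bound is attained.\<close>
    have "4 * (a + na)\<^sup>2 + 3 * (2 * a + ma)\<^sup>2 = 1" "4 * (b + nb)\<^sup>2 + 3 * (2 * b + mb)\<^sup>2 = 1"
      "4 * (c + nc)\<^sup>2 + 3 * (2 * c + mc)\<^sup>2 = 1" "4 * (d + nd)\<^sup>2 + 3 * (2 * d + md)\<^sup>2 = 1"
      using T A(1) B(1) C(1) D(1) by linarith+
    thus ?thesis using A(2) B(2) C(2) D(2) by (simp add: q quads_def)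
  qed
  moreover have "?n \<in> quads \<int>" "?m \<in> quads \<int>" by (simp_all add: quads_def)
  ultimately show ?thesis using that by blast
qed

section \<open>An element of least norm generates the ideal\<close>

lemma module_subset_Otheta:
  assumes K: "J \<subseteq> Ktheta" and one: "1 \<in> J"
    and add: "\<And>x y. x \<in> J \<Longrightarrow> y \<in> J \<Longrightarrow> x + y \<in> J"
    and mult: "\<And>x y. x \<in> Otheta \<Longrightarrow> y \<in> J \<Longrightarrow> x * y \<in> J"
    and N: "\<And>q. q \<in> quads \<rat> \<Longrightarrow> qval theta q \<in> J \<Longrightarrow> q \<noteq> (0, 0, 0, 0) \<Longrightarrow> qN q \<ge> 1"
  shows "J \<subseteq> Otheta"
proof
  have OJ: "x \<in> J" if "x \<in> Otheta" for x using mult[OF that one] by simp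
  have th: "y \<in> Otheta" if "y \<in> J" "theta * y \<in> Otheta" for y
  proof (rule ccontr)
    assume "y \<notin> Otheta"
    then obtain t where "t \<in> Otheta" "y + t = qval theta (0, 0, - 1 / 2, - 1 / 2)"
      using Otheta_mult_theta_cases[OF \<open>theta * y \<in> Otheta\<close>] by blast
    hence "qval theta (0, 0, - 1 / 2, - 1 / 2) \<in> J" using add[OF \<open>y \<in> J\<close> OJ] by metis
    \<comment> \<open>This is 1 / \<open>theta\<close>, with T = 1 and V = 1/2, hence of norm
      1/2.\<close>
    hence "qN (0, 0, - 1 / 2, - 1 / 2) \<ge> 1" by (intro N) (auto simp: quads_def)
    thus False by (simp add: qN_def power2_eq_square)
  qed
  have two: "y \<in> Otheta" if "y \<in> J" "2 * y \<in> Otheta" for y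
  proof -
    have J: "theta * x \<in> J" if "x \<in> J" for x using mult[OF theta_in_Otheta that] .
    \<comment> \<open>The cofactor in \<open>theta ^ 4\<close> = 2 (-1 - 2
      \<open>theta ^ 2\<close>). So \<open>theta ^ 4\<close> y is integral as soon as 2y is, and
      \<open>th\<close> strips the four factors one at a time.\<close>
    have "of_int (-1) + of_int (-2) * (theta * theta) \<in> Otheta"
      by (intro Otheta_closed Otheta_of_int theta_in_Otheta)
    hence "(of_int (-1) + of_int (-2) * (theta * theta)) * (2 * y) \<in> Otheta" by (rule Otheta_closed) (rule that)
    moreover have "(theta * theta + 2) * (theta * theta + 2) = 2"
      using theta_roots4 by (simp add: roots4_def power2_eq_square)
    from arg_cong[OF this, of "\<lambda>x. x * y"]
    have "theta * (theta * (theta * (theta * y))) = (of_int (-1) + of_int (-2) * (theta * theta)) * (2 * y)"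
      by (simp add: algebra_simps eq_neg_iff_add_eq_0)
    ultimately show ?thesis using that(1) th J by metis
  qed
  have small: "qval theta q \<in> Otheta" if "q \<in> quads \<rat>" "qval theta q \<in> J" "qT q < 1" for q
  proof -
    \<comment> \<open>The norm is at most T^2 < 1, which only zero can satisfy in J.\<close>
    have "(qT q)\<^sup>2 < 1" using that(3) qT_nonneg[of q] by (simp add: power_less_one_iff abs_square_less_1)
    hence "q = (0, 0, 0, 0)" using N[OF that(1,2)] qN_le[of q] by fastforce
    thus ?thesis using Otheta_of_int[of 0] by simp
  qed
  have cancel: "x \<in> Otheta" if "x + qval theta n \<in> Otheta" "n \<in> quads \<int>" for x n
  proof -
    have "of_int (-1) * qval theta n \<in> Otheta"
      by (rule Otheta_closed(2)[OF Otheta_of_int]) (use that in \<open>auto simp: Otheta_eq\<close>)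
    from Otheta_closed(1)[OF that(1) this] show ?thesis by simp
  qed
  have O: "qval theta n \<in> Otheta" if "n \<in> quads \<int>" for n using that by (auto simp: Otheta_eq)
  fix x assume x: "x \<in> J"
  then obtain q where q: "q \<in> quads \<rat>" "x = qval theta q" using K by (auto simp: Ktheta_eq)
  have v: "qval theta (qmul (of_int k, 0, 0, 0) q) = of_int k * x" for k
    unfolding q(2) by (subst qval_qmul[OF theta_roots4]) simp
  have kJ: "of_int k * x \<in> J" for k by (rule mult[OF Otheta_of_int x])
  have kq: "qmul (of_int k, 0, 0, 0) q \<in> quads \<rat>" for k
    by (rule quads_closed[OF _ q(1)]) (auto simp: quads_def)
  obtain n m where nm: "n \<in> quads \<int>" "m \<in> quads \<int>"
    and "qT (qadd q n) < 1 \<or> qT (qadd (qmul (2, 0, 0, 0) q) m) < 1 \<or> qmul (4, 0, 0, 0) q \<in> quads \<int>"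
    by (rule quad_rounding)
  then consider (1) "qT (qadd q n) < 1" | (2) "qT (qadd (qmul (2, 0, 0, 0) q) m) < 1" | (4) "qmul (4, 0, 0, 0) q \<in> quads \<int>"
    by blast
  then show "x \<in> Otheta"
  proof cases
    case 1
    have "qval theta (qadd q n) \<in> Otheta"
      by (rule small[OF _ _ 1]) (use quads_closed q nm quads_Ints_Rats O OJ add x in \<open>auto simp: qval_qadd\<close>)
    thus ?thesis using cancel nm by (simp add: qval_qadd q)
  next
    case 2
    have "qval theta (qadd (qmul (2, 0, 0, 0) q) m) \<in> Otheta"
      by (rule small[OF _ _ 2]) (use v[of 2] kq[of 2] kJ[of 2] quads_closed nm quads_Ints_Rats O OJ add in \<open>auto simp: qval_qadd\<close>)
    hence "2 * x \<in> Otheta" using cancel nm v[of 2] by (simp add: qval_qadd)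
    thus ?thesis by (rule two[OF x])
  next
    case 4
    have "2 * (2 * x) \<in> Otheta" using O[OF 4] v[of 4] by simp
    hence "2 * x \<in> Otheta" using two kJ[of 2] by simp
    thus ?thesis by (rule two[OF x])
  qed
qed

lemma Ktheta_inverse:
  assumes "x \<in> Ktheta" "x \<noteq> 0"
  obtains y where "y \<in> Ktheta" "y * x = 1"
proof -
  obtain q where q: "q \<in> quads \<rat>" "x = qval theta q" using assms(1) by (auto simp: Ktheta_eq)
  obtain a b c d where abcd: "q = (a, b, c, d)" by (cases q) auto
  have "qN q \<noteq> 0"
  proof
    assume "qN q = 0"
    hence "q = (0, 0, 0, 0)" by (rule qN_eq_0[OF q(1)])
    thus False using assms(2) q(2) by simp
  qed
  \<comment> \<open>The conjugate (a, b, -c, -d) over Q(sqrt 2) turns q into T + V sqrt 2; the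
    factor T - V sqrt 2 turns this into the rational number \<open>qN q\<close>, which is then
    divided out.\<close>
  define y where "y = qmul (1 / qN q, 0, 0, 0) (qmul (qT q, - qV q, 0, 0) (a, b, - c, - d))"
  have "qmul (a, b, - c, - d) q = (qT q, qV q, 0, 0)"
    unfolding abcd by (simp add: power2_eq_square algebra_simps)
  moreover have "qmul (qT q, - qV q, 0, 0) (qT q, qV q, 0, 0) = (qN q, 0, 0, 0)"
    by (simp add: qN_def power2_eq_square)
  ultimately have "qval theta y * x = qval theta (1 / qN q, 0, 0, 0) * qval theta (qN q, 0, 0, 0)"
    unfolding y_def q(2) qval_qmul[OF theta_roots4] mult.assoc by (metis qval_qmul[OF theta_roots4])
  also have "\<dots> = 1" using \<open>qN q \<noteq> 0\<close> by (simp flip: of_real_mult)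
  finally have "qval theta y * x = 1" .
  moreover have "y \<in> quads \<rat>" unfolding y_def
    by (intro quads_closed) (use qT_qV_qN_closed[OF q(1)] q(1) abcd in \<open>auto simp: quads_def\<close>)
  ultimately show ?thesis using that by (auto simp: Ktheta_eq)
qed

lemma Otheta_subset_Ktheta: "Otheta \<subseteq> Ktheta"
  using quads_Ints_Rats by (auto simp: Ktheta_eq Otheta_eq)

text \<open>Dividing I by the chosen element gives a module J containing 1, and multiplicativity of
  the norm turns minimality into the bound 1 required by
  \<open>module_subset_Otheta\<close>.\<close>

lemma norm_minimal_generates:
  assumes I: "I \<subseteq> Otheta"
    and add: "\<And>x y. x \<in> I \<Longrightarrow> y \<in> I \<Longrightarrow> x + y \<in> I"
    and mult: "\<And>x y. x \<in> Otheta \<Longrightarrow> y \<in> I \<Longrightarrow> x * y \<in> I"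
    and p: "p \<in> quads \<int>" "qval theta p \<in> I" "p \<noteq> (0, 0, 0, 0)"
    and min: "\<And>q. q \<in> quads \<int> \<Longrightarrow> qval theta q \<in> I \<Longrightarrow> q \<noteq> (0, 0, 0, 0) \<Longrightarrow> qN p \<le> qN q"
  shows "I = {x * qval theta p | x. x \<in> Otheta}"
proof (intro equalityI subsetI)
  fix x assume "x \<in> {x * qval theta p | x. x \<in> Otheta}"
  thus "x \<in> I" using mult p(2) by blast
next
  have pQ: "p \<in> quads \<rat>" using p(1) by (rule quads_Ints_Rats)
  have nz: "qval theta p \<noteq> 0" using qval_eq_0[OF pQ] p(3) by blast
  have pos: "qN p > 0" using qN_nonneg[of p] qN_eq_0[OF pQ] p(3) by fastforce
  define J where "J = {x \<in> Ktheta. x * qval theta p \<in> I}"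
  have "J \<subseteq> Otheta"
  proof (rule module_subset_Otheta)
    show "J \<subseteq> Ktheta" by (auto simp: J_def)
    show "1 \<in> J" using p(2) of_rat_in_Ktheta[of 1] by (simp add: J_def)
    show "x + y \<in> J" if "x \<in> J" "y \<in> J" for x y
      using that add by (auto simp: J_def Ktheta_closed distrib_right)
    show "x * y \<in> J" if "x \<in> Otheta" "y \<in> J" for x y
      using that mult Otheta_subset_Ktheta by (auto simp: J_def Ktheta_closed mult.assoc)
    show "qN q \<ge> 1" if q: "q \<in> quads \<rat>" "qval theta q \<in> J" "q \<noteq> (0, 0, 0, 0)" for q
    proof -
      have qp: "qmul q p \<in> quads \<rat>" using quads_closed q(1) pQ by blast
      have v: "qval theta (qmul q p) = qval theta q * qval theta p" by (rule qval_qmul[OF theta_roots4])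
      have inI: "qval theta (qmul q p) \<in> I" using q(2) by (simp add: J_def v)
      then obtain s where s: "s \<in> quads \<int>" "qval theta (qmul q p) = qval theta s" using I by (auto simp: Otheta_eq)
      hence e: "qmul q p = s" using qval_inj qp quads_Ints_Rats by blast
      have "qval theta q \<noteq> 0" using qval_eq_0 q by blast
      hence "qval theta s \<noteq> 0" using nz v s by simp
      hence "s \<noteq> (0, 0, 0, 0)" by auto
      hence "qN p \<le> qN q * qN p" using min[OF s(1)] inI s(2) e by (metis qN_qmul)
      thus ?thesis using pos by simp
    qed
  qed
  moreover fix x assume x: "x \<in> I"
  obtain y where y: "y \<in> Ktheta" "y * qval theta p = 1"
    using Ktheta_inverse nz I p(2) Otheta_subset_Ktheta by (metis subsetD)
  have "x * y \<in> J" using x I Otheta_subset_Ktheta y by (auto simp: J_def Ktheta_closed mult.assoc)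
  moreover have "x = (x * y) * qval theta p" using y by (simp add: mult.assoc)
  ultimately show "x \<in> {x * qval theta p | x. x \<in> Otheta}" by blast
qed

section \<open>Choice of a shortest generator\<close>

lemma arg_min_int_valued:
  fixes f :: "'a \<Rightarrow> real"
  assumes "P x" "\<And>y. P y \<Longrightarrow> f y \<in> \<int>" "\<And>y. P y \<Longrightarrow> f y \<ge> 0"
  obtains z where "P z" "\<And>y. P y \<Longrightarrow> f z \<le> f y"
proof -
  \<comment> \<open>Well-ordering is applied to the floors, which equal f itself because its values
    are nonnegative integers.\<close>
  obtain z where z: "P z" "\<And>y. P y \<Longrightarrow> nat \<lfloor>f z\<rfloor> \<le> nat \<lfloor>f y\<rfloor>"
    using ex_has_least_nat[of P x "\<lambda>y. nat \<lfloor>f y\<rfloor>"] assms(1) by blast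
  have "f z \<le> f y" if "P y" for y
  proof -
    have "\<lfloor>f z\<rfloor> \<le> \<lfloor>f y\<rfloor>" using z(2)[OF that] assms(3)[OF that] by (simp add: nat_le_eq_zle)
    hence "of_int \<lfloor>f z\<rfloor> \<le> (of_int \<lfloor>f y\<rfloor> :: real)" by simp
    thus ?thesis using assms(2)[OF that] assms(2)[OF z(1)] by (simp add: of_int_floor)
  qed
  thus ?thesis using that z(1) by blast
qed

theorem theorem8:
  assumes "ideal I Otheta_ring"
    and "I \<noteq> {0}"
  shows "\<exists>\<alpha>'\<in>I. \<alpha>' \<noteq> 0 \<and> I = PIdl\<^bsub>Otheta_ring\<^esub> \<alpha>' \<and>
           (\<forall>\<gamma>\<in>I. \<gamma> \<noteq> 0 \<longrightarrow> canon_norm \<alpha>' \<le> canon_norm \<gamma>)"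
proof -
  interpret ideal I Otheta_ring by fact
  have I: "I \<subseteq> Otheta" using a_subset by (simp add: Otheta_ring_def)
  have add: "x + y \<in> I" if "x \<in> I" "y \<in> I" for x y
    using additive_subgroup.a_closed[OF is_additive_subgroup that] by (simp add: Otheta_ring_def)
  have mult: "x * y \<in> I" if "x \<in> Otheta" "y \<in> I" for x y
    using I_l_closed[OF that(2)] that(1) by (simp add: Otheta_ring_def)
  have "0 \<in> I" using additive_subgroup.zero_closed[OF is_additive_subgroup] by (simp add: Otheta_ring_def)
  then obtain x where "x \<in> I" "x \<noteq> 0" using assms(2) by blast
  define P where "P q \<longleftrightarrow> q \<in> quads \<int> \<and> qval theta q \<in> I \<and> q \<noteq> (0, 0, 0, 0)" for q
  obtain p0 where "P p0" using \<open>x \<in> I\<close> \<open>x \<noteq> 0\<close> I unfolding Otheta_eq P_def by fastforce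
  then obtain p1 where p1: "P p1" "\<And>q. P q \<Longrightarrow> qN p1 \<le> qN q"
    by (rule arg_min_int_valued[of P _ qN]) (auto simp: P_def qT_qV_qN_closed qN_nonneg)
  have "P p1 \<and> qN p1 = qN p1" using p1 by simp
  \<comment> \<open>Second minimisation: the shortest element among those of least norm.\<close>
  then obtain p where p: "P p \<and> qN p = qN p1" "\<And>q. P q \<and> qN q = qN p1 \<Longrightarrow> qT p \<le> qT q"
    by (rule arg_min_int_valued[of "\<lambda>q. P q \<and> qN q = qN p1" _ qT]) (auto simp: P_def qT_qV_qN_closed qT_nonneg)
  have pI: "p \<in> quads \<int>" "qval theta p \<in> I" "p \<noteq> (0, 0, 0, 0)" using p(1) by (auto simp: P_def)
  have pQ: "p \<in> quads \<rat>" using pI(1) by (rule quads_Ints_Rats)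
  have nz: "qval theta p \<noteq> 0" using qval_eq_0[OF pQ] pI(3) by blast
  have pos: "qN p > 0" using qN_nonneg[of p] qN_eq_0[OF pQ] pI(3) by fastforce
  have gen: "I = {x * qval theta p | x. x \<in> Otheta}"
    by (rule norm_minimal_generates[OF I add mult pI]) (use p p1 in \<open>auto simp: P_def\<close>)
  have unit: "qT p \<le> qT u * qT p + 2 * qV u * qV p" if u: "u \<in> quads \<int>" "qN u = 1" for u
  proof -
    have "qmul u p \<in> quads \<int>" using quads_closed u pI by blast
    moreover have "qval theta (qmul u p) \<in> I"
      unfolding qval_qmul[OF theta_roots4] by (rule mult) (use u pI in \<open>auto simp: Otheta_eq\<close>)
    moreover have "qN (qmul u p) = qN p" using u by (simp add: qN_qmul)
    moreover from this have "qmul u p \<noteq> (0, 0, 0, 0)" using pos by (auto simp: qN_def)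
    ultimately have "qT p \<le> qT (qmul u p)" using p by (auto simp: P_def)
    thus ?thesis by (simp add: qT_qmul)
  qed
  have "2 * \<bar>qV p\<bar> \<le> qT p"
    \<comment> \<open>The units 1 + sqrt 2 and 1 - sqrt 2 have T = 3 and V = 2 or -2, so T is at
      most both 3T + 4V and 3T - 4V.\<close>
    using unit[of "(1, 1, 0, 0)"] unit[of "(1, -1, 0, 0)"] by (simp add: quads_def qN_def)
  hence "(2 * \<bar>qV p\<bar>)\<^sup>2 \<le> (qT p)\<^sup>2" by (rule power_mono) simp
  hence T2: "(qT p)\<^sup>2 \<le> 2 * qN p" by (simp add: qN_def power_mult_distrib)
  have short: "canon_norm (qval theta p) \<le> canon_norm \<gamma>" if \<gamma>: "\<gamma> \<in> I" "\<gamma> \<noteq> 0" for \<gamma>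
  proof -
    obtain x where "x \<in> Otheta" "\<gamma> = x * qval theta p" using gen \<gamma>(1) by blast
    then obtain w where w: "w \<in> quads \<int>" "\<gamma> = qval theta (qmul w p)"
      by (auto simp: Otheta_eq qval_qmul[OF theta_roots4])
    have g: "qmul w p \<in> quads \<int>" using quads_closed w pI by blast
    have Pg: "P (qmul w p)" using g \<gamma> w by (auto simp: P_def)
    have "qT p \<le> qT (qmul w p)"
    \<comment> \<open>If w has norm 1, the multiple again has least norm and the choice of p
      decides. Otherwise integrality forces norm at least 2, which \<open>T2\<close> converts into a
      bound on length.\<close>
    proof (cases "qN w = 1")
      case True
      then show ?thesis using p Pg by (auto simp: qN_qmul)
    next
      case False
      have "qN p \<le> qN w * qN p" using p1(2)[OF Pg] p(1) by (simp add: qN_qmul)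
      hence "qN w \<ge> 1" using pos by simp
      moreover obtain k where "qN w = of_int k" using qT_qV_qN_closed(3)[OF w(1)] by (auto simp: Ints_def)
      ultimately have "qN w \<ge> 2" using False by simp
      have "(qT p)\<^sup>2 \<le> 2 * qN p" by (rule T2)
      also have "\<dots> \<le> qN w * qN p" using \<open>qN w \<ge> 2\<close> pos by simp
      also have "\<dots> \<le> (qT (qmul w p))\<^sup>2" using qN_le[of "qmul w p"] by (simp add: qN_qmul)
      finally show ?thesis using qT_nonneg by (rule power2_le_imp_le)
    qed
    thus ?thesis using canon_norm_qval pQ quads_Ints_Rats[OF g] w(2) by simp
  qed
  show ?thesis
  proof (intro bexI[OF _ pI(2)] conjI ballI impI)
    show "qval theta p \<noteq> 0" by (rule nz)
    show "I = PIdl\<^bsub>Otheta_ring\<^esub> qval theta p"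
      unfolding cgenideal_def by (subst gen) (simp add: Otheta_ring_def)
  qed (rule short)
qed

end
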